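(* Every $\alpha_1$-metric graph is $1$-hyperbolic.
   Context: All graphs are finite, undirected, unweighted, simple and connected; $d(u,v)$ is the shortest-path distance, and $I(u,v)=\{w : d(u,v)=d(u,w)+d(w,v)\}$. A graph is $\alpha_1$-metric if for all vertices $u,v,w,x$ such that $v\in I(u,w)$, $w \in I(v,x)$ and $v,w$ are adjacent, one has $d(u,x)\ge d(u,v)+d(v,x)-1$. A graph is $\delta$-hyperbolic if for all vertices $u,v,w,x$ with $d(u,v)+d(w,x)\le d(u,w)+d(v,x)\le d(u,x)+d(v,w)$ one has $d(u,x)+d(v,w)-d(u,w)-d(v,x)\le 2\delta$. *)

theory Defs
  imports "Graph_Theory.Graph_Theory"
begin

text \<open>
  A finite simple undirected graph is the library's \<open>graph\<close>: a finite symmetric digraph without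
  loops and without parallel arcs. Each undirected edge is a pair of opposite arcs, so the number of
  arcs of a walk is its number of edges. Distances are real numbers, so that subtraction does not
  truncate; \<open>real_of_ereal\<close> is harmless since distances in a connected graph are finite.
\<close>

definition gdist :: "('a, 'b) pre_digraph \<Rightarrow> 'a \<Rightarrow> 'a \<Rightarrow> real" where
  "gdist G u v = real_of_ereal (wf_digraph.\<mu> G (\<lambda>_. 1) u v)"

definition interval :: "('a, 'b) pre_digraph \<Rightarrow> 'a \<Rightarrow> 'a \<Rightarrow> 'a set" where
  "interval G u v = {w \<in> verts G. gdist G u v = gdist G u w + gdist G w v}"

definition alpha1_metric :: "('a, 'b) pre_digraph \<Rightarrow> bool" where
  "alpha1_metric G \<longleftrightarrow>
     (\<forall>u \<in> verts G. \<forall>v \<in> verts G. \<forall>w \<in> verts G. \<forall>x \<in> verts G.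
        v \<in> interval G u w \<and> w \<in> interval G v x \<and> v \<rightarrow>\<^bsub>G\<^esub> w \<longrightarrow>
        gdist G u x \<ge> gdist G u v + gdist G v x - 1)"

definition hyperbolic :: "real \<Rightarrow> ('a, 'b) pre_digraph \<Rightarrow> bool" where
  "hyperbolic \<delta> G \<longleftrightarrow>
     (\<forall>u \<in> verts G. \<forall>v \<in> verts G. \<forall>w \<in> verts G. \<forall>x \<in> verts G.
        gdist G u v + gdist G w x \<le> gdist G u w + gdist G v x \<and>
        gdist G u w + gdist G v x \<le> gdist G u x + gdist G v w \<longrightarrow>
        gdist G u x + gdist G v w - gdist G u w - gdist G v x \<le> 2 * \<delta>)"

lemma gdist_eq_Least:
  assumes "graph G" "connected G" "u \<in> verts G" "v \<in> verts G"
  shows "gdist G u v = real (LEAST n. \<exists>p. pre_digraph.awalk G u p v \<and> length p = n)"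
proof -
  interpret graph G by (fact assms(1))
  let ?P = "\<lambda>n. \<exists>p. awalk u p v \<and> length p = n"
  let ?n = "LEAST n. ?P n"
  have cost: "awalk_cost (\<lambda>_. 1) p = real (length p)" for p :: "'b list"
    by (induction p) (auto simp: awalk_cost_def)
  have "strongly_connected G"
    using assms(2) sym_arcs by (simp add: connected_def strongly_connected_def reachable_mk_symmetric_eq)
  then have "u \<rightarrow>\<^sup>*\<^bsub>G\<^esub> v"
    using assms(3,4) by (auto simp: strongly_connected_def)
  then obtain q where "awalk u q v"
    by (auto simp: reachable_awalk)
  then have "?P (length q)" by blast
  then have "?P ?n" by (rule LeastI)
  then obtain p where p: "awalk u p v" "length p = ?n" by blast
  have "\<mu> (\<lambda>_. 1) u v = ereal (real ?n)"
    unfolding \<mu>_def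
  proof (rule INF_eqI)
    fix r assume "r \<in> {p. awalk u p v}"
    then have "?P (length r)" by blast
    then have "?n \<le> length r" by (rule Least_le)
    then show "ereal (real ?n) \<le> ereal (awalk_cost (\<lambda>_. 1) r)" by (simp add: cost)
  next
    fix y assume "\<And>r. r \<in> {p. awalk u p v} \<Longrightarrow> y \<le> ereal (awalk_cost (\<lambda>_. 1) r)"
    from this[of p] p show "y \<le> ereal (real ?n)" by (simp add: cost)
  qed
  then show ?thesis by (simp add: gdist_def)
qed

end

theory Submission
  imports Defs
begin

text \<open>
  The \<open>\<alpha>\<^sub>1\<close>-property makes discs convex; hence the neighbours of c lying nearer to x form a clique.
  It also makes every slice of an interval have diameter at most 2. Call
  d(a,c) - d(b,a) - d(b,c) + 2 d(b,p) the slack of p; it is twice the amount by which the distance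
  from b to p exceeds the Gromov product of a and c at b, and it has the parity of the perimeter of
  a, b, c. A triple of minimal perimeter shows that some vertex of the interval between a and c has
  slack at most 2, and then every geodesic from a to c contains a vertex of slack at most 4.

  Along a geodesic from a to c the distance to b decreases until it is minimal and increases
  afterwards, each time with at most one flat step. For four points a, b, c, e take a geodesic
  through a vertex of small slack for b, and travel from b to e through a vertex of this geodesic
  where both distances are minimal, or through an end of one of the two minimal ranges if these
  ranges are disjoint.
\<close>

section \<open>Spaces with the \<open>\<alpha>\<^sub>1\<close>-property\<close>

text \<open>Points at distance 0 need not be equal. This allows the distance of a graph to be
  extended from its vertices to the whole type.\<close>

locale alpha1_space =
  fixes d :: "'a \<Rightarrow> 'a \<Rightarrow> int"
  assumes d_self: "d x x = 0"
    and d_sym: "d x y = d y x"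
    and d_tri: "d x z \<le> d x y + d y z"
    and d_step: "d x y > 0 \<Longrightarrow> \<exists>z. d x z = 1 \<and> d z y = d x y - 1"
    and alpha1: "\<lbrakk>d v w = 1; d u w = d u v + 1; d v x = d w x + 1\<rbrakk> \<Longrightarrow> d u v + d w x \<le> d u x"
begin

section \<open>Metric preliminaries, convexity of discs, thin slices of intervals\<close>

lemma d_nonneg: "0 \<le> d x y"
  using d_tri[of x x y] d_self[of x] d_sym[of x y] by linarith

lemma alpha1_sym:
  assumes "d v w = 1" "d u w = d u v + 1" "d x v = d x w + 1"
  shows "d u v + d x w \<le> d u x"
  using alpha1[of v w u x] assms d_sym[of x v] d_sym[of x w] by linarith

lemma d_between:
  assumes "0 \<le> k" "k \<le> d x y"
  obtains z where "d x z = k" "d z y = d x y - k"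
proof -
  have "\<exists>z. d x z = k \<and> d z y = d x y - k" using assms
  proof (induction "nat k" arbitrary: k x)
    case 0
    then show ?case using d_self[of x] by force
  next
    case (Suc n)
    then have "d x y > 0" by linarith
    then obtain x' where x': "d x x' = 1" "d x' y = d x y - 1" using d_step by blast
    have "n = nat (k - 1)" "0 \<le> k - 1" "k - 1 \<le> d x' y" using Suc x' by linarith+
    then obtain z where z: "d x' z = k - 1" "d z y = d x' y - (k - 1)" using Suc(1) by blast
    have "d x z = k" using z x' d_tri[of x z x'] d_tri[of x y z] by linarith
    then show ?case using z x' by auto
  qed
  then show ?thesis using that by blast
qed

text \<open>On a geodesic from \<open>x\<close> to \<open>y\<close>, let the edge from
  \<open>z'\<close> to \<open>z\<close> be the first to leave the disc. Then \<open>alpha1\<close>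
  across it gives \<open>k + d z y \<le> d b y \<le> k\<close>, so \<open>z\<close> is at distance 0
  from \<open>y\<close>, which lies in the disc.\<close>

lemma disc_convex:
  assumes "d b x \<le> k" "d b y \<le> k" "d x z + d z y = d x y"
  shows "d b z \<le> k"
  using assms
proof (induction "nat (d x z)" arbitrary: z)
  case 0
  then have "d x z = 0" using d_nonneg[of x z] by linarith
  then show ?case using 0 d_tri[of b z x] by linarith
next
  case (Suc n)
  then have "d z x > 0" using d_sym[of x z] by linarith
  then obtain z' where z': "d z z' = 1" "d z' x = d z x - 1" using d_step by blast
  have xz': "d x z' = d x z - 1" "d z' z = 1" using z' d_sym[of x z] d_sym[of x z'] d_sym[of z z'] by linarith+
  have z'y: "d z' y = d z y + 1"
    using xz' Suc.prems d_tri[of z' y z] d_tri[of x y z'] by linarith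
  have "d b z' \<le> k" by (rule Suc.hyps(1)) (use Suc.hyps(2) Suc.prems xz' z'y in linarith)+
  show ?case
  proof (rule ccontr)
    assume "\<not> d b z \<le> k"
    then have e: "d b z = d b z' + 1" "d b z' = k"
      using \<open>d b z' \<le> k\<close> d_tri[of b z z'] xz' by linarith+
    have "d b z' + d z y \<le> d b y" using alpha1[of z' z b y] xz' e z'y by auto
    then have "d y z = 0" using e Suc.prems d_nonneg[of z y] d_sym[of z y] by linarith
    then show False using d_tri[of b z y] Suc.prems \<open>\<not> d b z \<le> k\<close> by linarith
  qed
qed

text \<open>At distance 2 the two neighbours would have \<open>c\<close> between them, and the disc
  of radius \<open>d c x - 1\<close> around \<open>x\<close> would contain \<open>c\<close>.\<close>

lemma neighbours_adjacent:
  assumes "d c p = 1" "d c q = 1" "d p x = d c x - 1" "d q x = d c x - 1"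
  shows "d p q \<le> 1"
proof (rule ccontr)
  assume "\<not> d p q \<le> 1"
  then have "d p c + d c q = d p q" using d_tri[of p q c] assms d_sym[of p c] by linarith
  then have "d x c \<le> d c x - 1"
    using disc_convex[of x p "d c x - 1" q c] assms d_sym[of x p] d_sym[of x q] by linarith
  then show False using d_sym[of c x] by linarith
qed

text \<open>Discs around \<open>u\<close> and \<open>v\<close> keep a geodesic between two points of
  a slice inside the slice, so a bad pair may be taken at distance exactly 3. Its neighbours
  \<open>s\<close> and \<open>t\<close> one level lower are at distance at most 2 by induction, and
  \<open>alpha1\<close> across the edge from \<open>x\<close> to \<open>s\<close> then puts
  \<open>t\<close> too far from \<open>v\<close>.\<close>

lemma slice_thin:
  assumes "d u x + d x v = d u v" "d u y + d y v = d u v" "d u x = d u y"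
  shows "d x y \<le> 2"
  using assms
proof (induction "nat (d u x)" arbitrary: x y)
  case 0
  then have "d u x = 0" using d_nonneg[of u x] by linarith
  then show ?case using 0 d_tri[of x y u] d_sym[of x u] by linarith
next
  case (Suc n)
  show ?case
  proof (rule ccontr)
    assume "\<not> d x y \<le> 2"
    then obtain y' where y': "d x y' = 3" "d y' y = d x y - 3" using d_between[of 3 x y] by force
    then have xy': "d x y' + d y' y = d x y" by simp
    have "d u y' \<le> d u x" using disc_convex[OF _ _ xy', of u "d u x"] Suc.prems by simp
    moreover have "d v y' \<le> d v x"
      using disc_convex[OF _ _ xy', of v "d v x"] Suc.prems by (smt (verit) d_sym)
    ultimately have uy': "d u y' = d u x" "d y' v = d x v"
      using d_tri[of u v y'] Suc.prems d_sym[of v x] d_sym[of v y'] by linarith+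
    have sym: "d x u = d u x" "d y' u = d u y'" "d v x = d x v" by (rule d_sym)+
    then have pos: "d x u > 0" "d y' u > 0" using Suc.hyps(2) uy' by linarith+
    obtain s where s: "d x s = 1" "d s u = d x u - 1" using d_step pos by blast
    obtain t where t: "d y' t = 1" "d t u = d y' u - 1" using d_step pos by blast
    have symst: "d u s = d s u" "d u t = d t u" "d s x = d x s" "d t y' = d y' t"
      "d v s = d s v" "d v t = d t v"
      by (rule d_sym)+
    have us: "d u s = d u x - 1" "d s v = d x v + 1"
      using s sym symst d_tri[of s v x] d_tri[of u v s] Suc.prems by linarith+
    have ut: "d u t = d u x - 1" "d t v = d x v + 1"
      using t uy' sym symst d_tri[of t v y'] d_tri[of u v t] Suc.prems by linarith+
    have st: "d s t \<le> 2"
      by (rule Suc.hyps(1)) (use Suc.hyps(2) Suc.prems us ut in linarith)+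
    have "d x t \<ge> 3"
    proof (rule ccontr)
      assume "\<not> 3 \<le> d x t"
      then have "d x t + d t y' = d x y'" using y' t symst d_tri[of x y' t] by linarith
      moreover have "d v y' = d y' v" by (rule d_sym)
      ultimately have "d v t \<le> d x v"
        using disc_convex[of v x "d x v" y' t] uy' sym by linarith
      then show False using ut symst by linarith
    qed
    then have xt: "d x t = d s t + 1" "d s t = 2" using s st d_tri[of x t s] by linarith+
    then have "d v x + d s t \<le> d v t" using s us sym symst by (intro alpha1) linarith+
    then show False using ut xt sym symst by linarith
  qed
qed

text \<open>The two left-hand sides are the detours via \<open>p\<close> on the way from
  \<open>b\<close> to \<open>a\<close> and to \<open>c\<close>; their sum is the slack of
  \<open>p\<close>. A neighbour \<open>z\<close> of \<open>p\<close> towards \<open>b\<close> lies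
  outside the interval, hence farther than \<open>p\<close> from \<open>a\<close> or from
  \<open>c\<close>, and \<open>alpha1\<close> across the edge from \<open>p\<close> to
  \<open>z\<close> bounds the corresponding detour.\<close>

lemma minimum_one_sided:
  assumes min: "\<And>q. d a q + d c q = d a c \<Longrightarrow> m \<le> d b q"
    and p: "d a p + d c p = d a c" "d b p = m"
  shows "m + d a p - d b a \<le> 1 \<or> m + d c p - d b c \<le> 1"
proof (cases "d b p = 0")
  case True
  then show ?thesis using p d_tri[of a p b] d_sym[of a b] d_sym[of p b] by linarith
next
  case False
  then have "0 < d p b" using d_nonneg[of p b] d_sym[of p b] by linarith
  then obtain z where z: "d p z = 1" "d z b = d p b - 1" using d_step by blast
  have sym: "d z b = d b z" "d p b = d b p" "d z p = d p z" "d a b = d b a" "d c b = d b c"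
    "d z c = d c z"
    by (rule d_sym)+
  have "d a z + d c z \<noteq> d a c" using min[of z] z p sym by linarith
  then have "d a z = d a p + 1 \<or> d c z = d c p + 1"
    using z p sym d_tri[of a z p] d_tri[of c z p] d_tri[of a c z] by linarith
  then show ?thesis
  proof
    assume "d a z = d a p + 1"
    then have "d a p + d z b \<le> d a b" using z by (intro alpha1) linarith+
    then show ?thesis using z sym p by linarith
  next
    assume "d c z = d c p + 1"
    then have "d c p + d z b \<le> d c b" using z by (intro alpha1) linarith+
    then show ?thesis using z sym p by linarith
  qed
qed

text \<open>The detour to \<open>a\<close> is at least 3. Hence a step towards \<open>a\<close>
  cannot increase the distance to \<open>b\<close>, and the minimum persists all the way to
  \<open>a\<close>, where the detour to \<open>a\<close> cannot be positive.\<close>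

lemma no_one_sided_minimum:
  assumes min: "\<And>q. d a q + d c q = d a c \<Longrightarrow> m \<le> d b q"
    and four: "4 \<le> d a c - d b a - d b c + 2 * m"
    and p: "d a p + d c p = d a c" "d b p = m" "m + d c p - d b c \<le> 1"
  shows False
  using p
proof (induction "nat (d a p)" arbitrary: p)
  case 0
  then have "d a p = 0" using d_nonneg[of a p] by linarith
  then show ?case using 0 four d_tri[of b p a] by linarith
next
  case (Suc n)
  have "d p a > 0" using Suc(2) d_sym[of a p] by linarith
  then obtain q where q: "d p q = 1" "d q a = d p a - 1" using d_step by blast
  have sym: "d p a = d a p" "d q a = d a q" "d q p = d p q" "d q c = d c q"
    by (rule d_sym)+
  have q': "d a q = d a p - 1" "d c q = d c p + 1"
    using q sym d_tri[of c q p] d_tri[of a c q] Suc.prems(1) by linarith+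
  then have qI: "d a q + d c q = d a c" using Suc.prems(1) by linarith
  have qb: "m \<le> d b q" "d b q \<le> m + 1"
    using min[OF qI] d_tri[of b q p] q Suc.prems(2) by linarith+
  have "d b q \<noteq> m + 1"
  proof
    assume *: "d b q = m + 1"
    have "d b p + d q a \<le> d b a" using q * Suc.prems(2) by (intro alpha1) linarith+
    then show False using q q' sym Suc.prems four by linarith
  qed
  then have bq: "d b q = m" using qb by linarith
  \<comment> \<open>The detour to \<open>a\<close> has dropped by only 1 and is still at least 2, so
    the small detour is again the one to \<open>c\<close>.\<close>
  then have "m + d c q - d b c \<le> 1"
    using minimum_one_sided[OF min qI bq] q' Suc.prems four by linarith
  moreover have "n = nat (d a q)" using Suc(2) q' by linarith
  ultimately show ?case using Suc(1) qI bq by blast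
qed

lemma interval_minimum:
  obtains p where "d a p + d c p = d a c" "d a c - d b a - d b c + 2 * d b p \<le> 3"
    "\<And>q. d a q + d c q = d a c \<Longrightarrow> d b p \<le> d b q"
proof -
  have sym: "d c a = d a c" by (rule d_sym)
  have "d a a + d c a = d a c" using d_self[of a] sym by simp
  then obtain p where p: "d a p + d c p = d a c"
    and "\<And>q. d a q + d c q = d a c \<Longrightarrow> nat (d b p) \<le> nat (d b q)"
    using ex_has_least_nat[of "\<lambda>q. d a q + d c q = d a c" a "\<lambda>q. nat (d b q)"] by blast
  then have min: "d b p \<le> d b q" if "d a q + d c q = d a c" for q
    using that d_nonneg[of b] by (metis nat_le_eq_zle le_cases nat_mono order_antisym)
  have "\<not> 4 \<le> d a c - d b a - d b c + 2 * d b p"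
  proof
    assume four: "4 \<le> d a c - d b a - d b c + 2 * d b p"
    have min': "d b p \<le> d b q" if "d c q + d a q = d c a" for q
      using min[of q] that sym by simp
    from minimum_one_sided[OF min p refl] show False
    proof
      assume "d b p + d a p - d b a \<le> 1"
      then show False using no_one_sided_minimum[of c a "d b p" b p] min' four p sym by simp
    next
      assume "d b p + d c p - d b c \<le> 1"
      then show False using no_one_sided_minimum[OF min four p] by simp
    qed
  qed
  then show thesis using that p min by force
qed

end

subsection \<open>Distance to an interval\<close>

text \<open>Slack at most 3 can always be attained (\<open>interval_minimum\<close>), so in a minimal counterexample
  the least slack is exactly 3, and F is the distance from b to the interval.\<close>

locale minimal_counterexample = alpha1_space d for d :: "'a \<Rightarrow> 'a \<Rightarrow> int" +
  fixes a b c :: 'a and F :: int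
  assumes eq: "d a c = d b a + d b c - 2 * F + 3"
    and min: "d a p + d c p = d a c \<Longrightarrow> F \<le> d b p"
    and smaller: "d a' c' + d b a' + d b c' < d a c + d b a + d b c \<Longrightarrow>
      \<exists>p. d a' p + d c' p = d a' c' \<and> d a' c' - d b a' - d b c' + 2 * d b p \<le> 2"
begin

section \<open>Neighbours of \<open>c\<close> in a minimal counterexample\<close>

lemma mirror: "minimal_counterexample d c b a F"
proof
  show "d c a = d b c + d b a - 2 * F + 3" using eq d_sym[of a c] by linarith
  show "F \<le> d b p" if "d c p + d a p = d c a" for p
    using min that d_sym[of a c] by (simp add: add.commute)
  show "\<exists>p. d a' p + d c' p = d a' c' \<and> d a' c' - d b a' - d b c' + 2 * d b p \<le> 2"
    if "d a' c' + d b a' + d b c' < d c a + d b c + d b a" for a' c'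
    by (rule smaller) (use that d_sym[of a c] in linarith)
qed

lemma ends: "F \<le> d b a" "F \<le> d b c"
  using min[of a] min[of c] d_self[of a] d_self[of c] d_sym[of a c] by linarith+

text \<open>Moving away from \<open>b\<close> would by \<open>alpha1\<close> force
  \<open>d b c < F\<close>. Moving towards \<open>b\<close> would leave all slacks unchanged in a
  triple of smaller perimeter, which has a vertex of slack at most 2.\<close>

lemma side_neighbour:
  assumes q: "d c q = 1" "d a q = d a c - 1"
  shows "d b q = d b c"
proof -
  have sym: "d c a = d a c" "d q c = d c q" "d a b = d b a" by (rule d_sym)+
  have "\<not> d b q = d b c + 1"
  proof
    assume "d b q = d b c + 1"
    then have "d b c + d a q \<le> d b a" using q by (intro alpha1_sym) linarith+
    then show False using q eq ends by linarith
  qed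
  moreover have "\<not> d b q = d b c - 1"
  proof
    assume *: "d b q = d b c - 1"
    obtain p where p: "d a p + d q p = d a q" "d a q - d b a - d b q + 2 * d b p \<le> 2"
      using smaller[of a q] q * by force
    have "d a p + d c p = d a c" using p q sym d_tri[of c p q] d_tri[of a c p] d_sym[of p c] by linarith
    then have "F \<le> d b p" by (rule min)
    then show False using p q * eq by linarith
  qed
  ultimately show ?thesis using d_tri[of b q c] d_tri[of b c q] q sym by linarith
qed

text \<open>Moving away from \<open>a\<close> would by \<open>alpha1\<close> force
  \<open>d b c < F\<close>, and a neighbour towards \<open>a\<close> is no nearer to
  \<open>b\<close> by \<open>side_neighbour\<close>.\<close>

lemma tip:
  assumes t: "d c t = 1" "d b t = d b c - 1"
  shows "d a t = d a c"
proof -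
  have "\<not> d a t = d a c + 1"
  proof
    assume "d a t = d a c + 1"
    then have "d a c + d b t \<le> d a b" using t by (intro alpha1_sym) linarith+
    then show False using t eq ends d_sym[of a b] by linarith
  qed
  moreover have "\<not> d a t = d a c - 1" using side_neighbour[of t] t by auto
  ultimately show ?thesis using d_tri[of a t c] d_tri[of a c t] t d_sym[of c t] by linarith
qed

lemma side_tip_not_adjacent:
  assumes q: "d c q = 1" "d a q = d a c - 1" and t: "d c t = 1" "d b t = d b c - 1"
  shows "2 \<le> d q t"
proof (rule ccontr)
  assume "\<not> 2 \<le> d q t"
  moreover have "d q t \<noteq> 0" using tip[OF t] q d_tri[of a t q] by linarith
  ultimately have "d q t = 1" using d_nonneg[of q t] by linarith
  then have "d a q + d b t \<le> d a b"
    using q t tip[OF t] side_neighbour[OF q] by (intro alpha1_sym) linarith+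
  then show False using q t eq ends d_sym[of a b] by linarith
qed

text \<open>The neighbours of \<open>c\<close> towards \<open>x\<close> form a clique, but
  \<open>q\<close> and \<open>t\<close> are not adjacent.\<close>

lemma side_far:
  assumes q: "d c q = 1" "d a q = d a c - 1" and t: "d c t = 1" "d b t = d b c - 1"
    and x: "d t x = d c x - 1"
  shows "d c x \<le> d q x"
proof (rule ccontr)
  assume "\<not> d c x \<le> d q x"
  then have "d q x = d c x - 1" using d_tri[of c x q] q by linarith
  then have "d q t \<le> 1" using neighbours_adjacent[OF q(1) t(1)] x by blast
  then show False using side_tip_not_adjacent[OF q t] by linarith
qed

text \<open>At distance 3, \<open>alpha1\<close> across the edge from \<open>c\<close> to
  \<open>t\<close> would put \<open>r\<close> farther from \<open>b\<close> than \<open>q\<close>;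
  then \<open>alpha1\<close> across the edge from \<open>q\<close> to \<open>r\<close> would make
  \<open>d b a\<close> too large.\<close>

lemma second_side_tip:
  assumes r: "d c r = 2" "d a r = d a c - 2" and t: "d c t = 1" "d b t = d b c - 1"
  shows "d r t \<le> 2"
proof (rule ccontr)
  assume "\<not> d r t \<le> 2"
  moreover have sym: "d r c = d c r" "d r b = d b r" "d b a = d a b" by (rule d_sym)+
  ultimately have rt: "d r t = d r c + 1" using r t d_tri[of r t c] by linarith
  obtain q where q: "d c q = 1" "d q r = 1" using d_between[of 1 c r] r by force
  have qa: "d a q = d a c - 1"
    using q r d_tri[of a c q] d_tri[of a q r] d_sym[of q c] d_sym[of q r] by linarith
  have "d r c + d b t \<le> d r b" using rt t by (intro alpha1_sym) linarith+
  then have br: "d b r = d b q + 1"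
    using side_neighbour[OF q(1) qa] d_tri[of b r q] q r t sym by linarith
  then have "d b q + d a r \<le> d b a" using q qa r by (intro alpha1_sym) linarith+
  then show False using br r eq ends side_neighbour[OF q(1) qa] by linarith
qed

lemma side_tip_dist:
  assumes p: "d a p + d c p = d a c" "2 \<le> d c p" and t: "d c t = 1" "d b t = d b c - 1"
  shows "d p t = d c p"
proof -
  obtain r where r: "d c r = 2" "d r p = d c p - 2" using d_between[of 2 c p] p by force
  have "d a r = d a c - 2"
    using r p d_tri[of a c r] d_tri[of a r p] d_sym[of r c] d_sym[of r p] by linarith
  then have "d r t \<le> 2" using second_side_tip r t by blast
  then show ?thesis
    using r p tip[OF t] d_tri[of p t r] d_tri[of a t p] d_sym[of r p] by linarith
qed

text \<open>Otherwise x would be at distance 2 from a vertex of the interval between a and c at the same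
  distance from a, and the vertex between the two contradicts the clique property at c.\<close>

lemma close_to_tip:
  assumes t: "d c t = 1" "d b t = d b c - 1" and x: "d a x + d t x = d a c" "d b x < F"
  shows "d t x \<le> 1"
proof (rule ccontr)
  assume l: "\<not> d t x \<le> 1"
  have at: "d a t = d a c" by (rule tip[OF t])
  have sym: "d c a = d a c" "d x c = d c x" "d x t = d t x" by (rule d_sym)+
  have "d c x \<noteq> d t x" using min[of x] x by auto
  then have cx: "d c x = d t x + 1"
    using d_tri[of c x t] d_tri[of a c x] t x sym by linarith
  obtain p where p: "d c p = d t x" "d p a = d c a - d t x"
    using d_between[of "d t x" c a] l x d_nonneg[of a x] sym by force
  have ap: "d a p = d a x" using p x sym d_sym[of a p] by linarith
  have pt: "d p t = d t x" using side_tip_dist[OF _ _ t, of p] p ap x l by auto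
  obtain q where q: "d c q = 1" "d q p = d t x - 1" using d_between[of 1 c p] p l by force
  have qa: "d a q = d a c - 1"
    using q p ap x d_tri[of a c q] d_tri[of a q p] d_sym[of q c] d_sym[of q p] by linarith
  have qx: "d t x + 1 \<le> d q x" using side_far[OF q(1) qa t, of x] cx by linarith
  \<comment> \<open>\<open>p\<close> and \<open>x\<close> lie in the same slice of the interval from
    \<open>a\<close> to \<open>t\<close>.\<close>
  have "d p x \<le> 2"
    by (rule slice_thin[of a p t x]) (use ap pt x at sym in linarith)+
  then have px: "d p x = 2" using qx q d_tri[of q x p] by linarith
  then obtain g where g: "d p g = 1" "d g x = 1" using d_between[of 1 p x] by force
  have pgx: "d p g + d g x = d p x" using g px by simp
  \<comment> \<open>The discs around \<open>a\<close> and \<open>t\<close> keep \<open>g\<close> in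
    the slice of \<open>p\<close> and \<open>x\<close>.\<close>
  have ag: "d a g \<le> d a x" by (rule disc_convex[OF _ _ pgx]) (use ap in linarith)+
  have tg: "d t g \<le> d t x" by (rule disc_convex[OF _ _ pgx]) (use pt d_sym[of p t] in linarith)+
  have g': "d a g = d a x" "d t g = d t x"
    using ag tg at x d_tri[of a t g] d_sym[of g t] by linarith+
  have "d c g \<noteq> d t x + 1"
    using side_far[OF q(1) qa t, of g] g' q g d_tri[of q g p] by linarith
  then have cg: "d c g = d t x"
    using g' t x d_tri[of c g t] d_tri[of a c g] d_sym[of g c] by linarith
  \<comment> \<open>Now \<open>g\<close> lies between \<open>a\<close> and \<open>c\<close>, so
    \<open>q'\<close> is a neighbour of \<open>c\<close> towards \<open>a\<close>, too close to
    \<open>x\<close> for \<open>side_far\<close>.\<close>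
  obtain q' where q': "d c q' = 1" "d q' g = d t x - 1" using d_between[of 1 c g] cg l by force
  have "d a q' = d a c - 1"
    using q' g' x d_tri[of a c q'] d_tri[of a q' g] d_sym[of q' c] d_sym[of q' g] by linarith
  then have "d c x \<le> d q' x" using side_far[OF q'(1) _ t, of x] cx by simp
  then show False using cx q' g d_tri[of q' x g] by linarith
qed

text \<open>The smaller triple \<open>a\<close>, \<open>t\<close>, \<open>b\<close> has a vertex
  below \<open>F\<close> next to \<open>t\<close>, so \<open>d b c = F + 1\<close> and
  \<open>d a c\<close> is at least 4. With \<open>p\<close> three steps from \<open>c\<close>, the
  triple \<open>p\<close>, \<open>t\<close>, \<open>b\<close> gives another such vertex, and
  convexity of a disc around \<open>t\<close> fails.\<close>

lemma no_height_at_c: "\<not> F < d b c"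
proof
  assume Fc: "F < d b c"
  have sym: "d a b = d b a" "d c b = d b c" "d c a = d a c" by (rule d_sym)+
  have "0 < d c b"
  proof (rule ccontr)
    assume "\<not> 0 < d c b"
    then have "F < 0" using Fc sym by linarith
    then show False using Fc \<open>\<not> 0 < d c b\<close> d_tri[of a c b] eq sym d_nonneg[of b c] by linarith
  qed
  then obtain t where t0: "d c t = 1" "d t b = d c b - 1" using d_step by blast
  have t: "d c t = 1" "d b t = d b c - 1" using t0 sym d_sym[of t b] by linarith+
  have at: "d a t = d a c" by (rule tip[OF t])
  obtain x where x: "d a x + d t x = d a t" "d a t - d b a - d b t + 2 * d b x \<le> 2"
    using smaller[of a t] at t by force
  \<comment> \<open>Passing from \<open>c\<close> to \<open>t\<close> raises every slack by 1, from
    3 to 4 at distance \<open>F\<close> from \<open>b\<close>.\<close>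
  have "d b x < F" using x t at eq by linarith
  then have "d t x \<le> 1" using close_to_tip[OF t] x at by simp
  then have bc: "d b c = F + 1"
    using \<open>d b x < F\<close> Fc t d_tri[of b t x] d_sym[of x t] by linarith
  have n: "d a c = d b a - F + 4" using eq bc by linarith
  \<comment> \<open>A value above \<open>F\<close> at the vertex \<open>y\<close> between
    \<open>r\<close> and \<open>t\<close>, or then at \<open>r\<close>, contradicts
    \<open>alpha1\<close> because \<open>n\<close> makes \<open>d a c\<close> large.\<close>
  have second: "d b r = F" if r: "d c r = 2" "d a r = d a c - 2" for r
  proof -
    obtain q where q: "d c q = 1" "d q r = 1" using d_between[of 1 c r] r by force
    have "d r t = 2" using second_side_tip[OF r t] at r d_tri[of a t r] by linarith
    then obtain y where y: "d r y = 1" "d y t = 1" using d_between[of 1 r t] by force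
    have ay: "d a y = d a c - 1" using y r at d_tri[of a y r] d_tri[of a t y] by linarith
    have "d b y \<noteq> F + 1"
    proof
      assume "d b y = F + 1"
      then have "d a y + d b t \<le> d a b" using y ay at t bc by (intro alpha1_sym) linarith+
      then show False using ay t bc n sym by linarith
    qed
    then have y2: "d b y \<le> F" using y t bc d_tri[of b y t] d_sym[of t y] by linarith
    have "\<not> d b r > F"
    proof
      assume "d b r > F"
      then have "d b r = d b y + 1" "d b y = F"
        using y2 y d_tri[of b r y] d_sym[of y r] by linarith+
      then have "d a r + d b y \<le> d a b" using y ay r by (intro alpha1_sym) linarith+
      then show False using \<open>d b y = F\<close> r n sym by linarith
    qed
    moreover have "F \<le> d b r" using min[of r] r by simp
    ultimately show ?thesis by linarith
  qed
  obtain p where p: "d c p = 3" "d p a = d c a - 3"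
    using d_between[of 3 c a] n ends sym by force
  have ap: "d a p = d a c - 3" using p sym d_sym[of a p] by linarith
  obtain r where r: "d c r = 2" "d r p = 1" using d_between[of 2 c p] p by force
  have ar: "d a r = d a c - 2"
    using r ap d_tri[of a c r] d_tri[of a r p] d_sym[of r c] d_sym[of r p] by linarith
  have br: "d b r = F" using second r ar by blast
  have "d b p \<noteq> F + 1"
  proof
    assume "d b p = F + 1"
    then have "d b r + d a p \<le> d b a" using r br ar ap by (intro alpha1_sym) linarith+
    then show False using br ap n by linarith
  qed
  then have bp: "d b p = F" using min[of p] p ap r br d_tri[of b p r] by linarith
  have pt: "d p t = 3" using side_tip_dist[OF _ _ t, of p] p ap by simp
  obtain x' where x': "d p x' + d t x' = d p t" "d p t - d b p - d b t + 2 * d b x' \<le> 2"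
    using smaller[of p t] pt bp t bc n ends by force
  \<comment> \<open>The sides of this triple are 3, \<open>F\<close>, \<open>F\<close>; the slack is
    odd, hence at most 1.\<close>
  have bx': "d b x' < F" using x' pt bp t bc by linarith
  have ax': "d a x' + d t x' = d a c"
    using x' pt ap at d_tri[of a x' p] d_tri[of a t x'] d_sym[of x' t] by linarith
  have "d t x' \<noteq> 0" using bx' t bc d_tri[of b t x'] d_sym[of x' t] by linarith
  then have tx': "d t x' = 1" using close_to_tip[OF t ax' bx'] d_nonneg[of t x'] by linarith
  then have "d p x' = 2" using x' pt by linarith
  then obtain g where g: "d p g = 1" "d g x' = 1" using d_between[of 1 p x'] by force
  have tg: "d t g = 2" "d a g = d a c - 2"
    using g tx' ap at d_tri[of a g p] d_tri[of a t g] d_sym[of g t] d_tri[of t g x'] d_sym[of x' g]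
    by linarith+
  have "d c g \<noteq> 2"
  proof
    assume "d c g = 2"
    then have bg: "d b g = F" using second tg by blast
    then have "d b g = d b x' + 1" using bx' g d_tri[of b g x'] d_sym[of x' g] by linarith
    then have "d a g + d b x' \<le> d a b" using g tg ax' tx' by (intro alpha1_sym) linarith+
    then show False using tg bg \<open>d b g = d b x' + 1\<close> n sym by linarith
  qed
  then have cg: "d c g = 3"
    using tg t d_tri[of c g t] d_tri[of a c g] d_sym[of g c] by linarith
  obtain q where q: "d c q = 1" "d q r = 1" using d_between[of 1 c r] r by force
  have "d a q = d a c - 1"
    using q ar d_tri[of a c q] d_tri[of a q r] d_sym[of q c] d_sym[of q r] by linarith
  then have "3 \<le> d q g" using side_far[OF q(1) _ t, of g] cg tg by simp
  \<comment> \<open>\<open>p\<close> lies between \<open>r\<close> and \<open>g\<close>, which are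
    both within 2 of \<open>t\<close>, whereas \<open>p\<close> is at distance 3 from
    \<open>t\<close>.\<close>
  then have rg: "d r p + d p g = d r g"
    using q g r d_tri[of q g r] d_tri[of r g p] by linarith
  have "d t p \<le> 2"
    by (rule disc_convex[OF _ _ rg]) (use second_side_tip[OF r(1) ar t] tg d_sym[of r t] in linarith)+
  then show False using pt d_sym[of p t] by linarith
qed

text \<open>The mirrored \<open>second_side_tip\<close> puts a neighbour \<open>p\<close> of
  \<open>c\<close> within 2 of \<open>s\<close>; if also \<open>d s t \<le> 2\<close>, this
  contradicts \<open>side_far\<close>. A distance of 4 violates \<open>alpha1\<close> across the
  edge from \<open>c\<close> to \<open>t\<close>, for \<open>s\<close> and \<open>b\<close>.\<close>

lemma tips_apart:
  assumes ac: "d a c = 3"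
    and s: "d a s = 1" "d b s = d b a - 1" and t: "d c t = 1" "d b t = d b c - 1"
    and le: "d b a \<le> d b c"
  shows "d s t = 3" "\<exists>p. d c p = 1 \<and> d a p = 2 \<and> d p s \<le> 2"
proof -
  interpret m: minimal_counterexample d c b a F by (rule mirror)
  have sym: "d c a = d a c" "d s c = d c s" "d s t = d t s" "d s b = d b s" by (rule d_sym)+
  have cs: "d c s = 3" using m.tip[OF s] ac sym by linarith
  obtain p where p: "d c p = 1" "d p a = 2" using d_between[of 1 c a] ac sym by force
  have ap: "d a p = 2" using p d_sym[of a p] by linarith
  have ps: "d p s \<le> 2" using m.second_side_tip[OF _ _ s, of p] p ap ac sym by simp
  then show "\<exists>p. d c p = 1 \<and> d a p = 2 \<and> d p s \<le> 2" using p ap by blast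
  have "\<not> d s t \<le> 2"
  proof
    assume "d s t \<le> 2"
    then have "d t s = d c s - 1" using cs t d_tri[of c s t] sym by linarith
    then have "d c s \<le> d p s" using side_far[OF p(1) _ t] ap ac by simp
    then show False using cs ps by linarith
  qed
  moreover have "d s t \<noteq> 4"
  proof
    assume "d s t = 4"
    then have "d s c + d b t \<le> d s b" using cs sym t by (intro alpha1_sym) linarith+
    then show False using cs s t le sym by linarith
  qed
  ultimately show "d s t = 3" using d_tri[of s t c] cs sym t by linarith
qed

text \<open>Such an \<open>x\<close> comes from the smaller triple \<open>s\<close>,
  \<open>t\<close>, \<open>b\<close>. If \<open>d c x = 2\<close>, the vertex \<open>e\<close>
  between them is another neighbour of \<open>c\<close> towards \<open>b\<close>, too close to
  \<open>s\<close>. Otherwise \<open>p\<close> is at distance at least 3 from \<open>x\<close>,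
  although discs around \<open>s\<close> and then around \<open>p\<close> put \<open>x\<close>
  within 2 of \<open>p\<close>.\<close>

lemma no_flat_point:
  assumes ac: "d a c = 3" and flat: "d b a = F" "d b c = F"
    and s: "d a s = 1" "d b s = d b a - 1" and t: "d c t = 1" "d b t = d b c - 1"
    and x: "d s x = 1" "d t x = 2" "d b x \<le> F - 2"
  shows False
proof -
  have le: "d b a \<le> d b c" using flat by simp
  have st: "d s t = 3" using tips_apart(1)[OF ac s t le] .
  obtain p where p: "d c p = 1" "d a p = d a c - 1" "d p s \<le> 2"
    using tips_apart(2)[OF ac s t le] ac by auto
  have "d c x \<noteq> 2"
  proof
    assume "d c x = 2"
    then obtain e where e: "d c e = 1" "d e x = 1" using d_between[of 1 c x] by force
    then have "d b e = d b c - 1"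
      using x flat d_tri[of b e x] d_tri[of b c e] d_sym[of e x] d_sym[of e c] by linarith
    then have "d s e = 3" using tips_apart(1)[OF ac s e(1) _ le] by blast
    then show False using x e d_tri[of s e x] d_sym[of e x] by linarith
  qed
  then have cx: "d c x = 3"
    using x t flat d_tri[of b c x] d_tri[of c x t] d_sym[of c x] by linarith
  then have px: "3 \<le> d p x" using side_far[OF p(1,2) t, of x] x by linarith
  obtain m where m: "d x m = 1" "d m t = 1"
    using d_between[of 1 x t] x d_sym[of x t] by force
  have sm: "d s x + d x m = d s m"
    using m x st d_tri[of s t m] d_tri[of s m x] by linarith
  have "d p m \<le> 2"
  proof (rule ccontr)
    assume "\<not> d p m \<le> 2"
    then have pm: "d p t + d t m = d p m"
      using p t m d_tri[of p t c] d_tri[of p m t] d_sym[of p c] d_sym[of t m] by linarith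
    have "d s t \<le> 2" by (rule disc_convex[OF _ _ pm]) (use p sm m x d_sym[of s p] in linarith)+
    then show False using st by linarith
  qed
  then have "d p x \<le> 2" using disc_convex[OF p(3) _ sm] by blast
  then show False using px by linarith
qed

lemma no_minimal_counterexample: False
proof -
  interpret m: minimal_counterexample d c b a F by (rule mirror)
  have flat: "d b a = F" "d b c = F" using no_height_at_c m.no_height_at_c ends by linarith+
  then have ac: "d a c = 3" using eq by linarith
  have sym: "d a b = d b a" "d c b = d b c" "d c a = d a c" by (rule d_sym)+
  have "2 \<le> F" using d_tri[of a c b] ac flat sym by linarith
  then obtain s t where st: "d a s = 1" "d s b = d a b - 1" "d c t = 1" "d t b = d c b - 1"
    using d_step[of a b] d_step[of c b] flat sym by auto
  then have s: "d a s = 1" "d b s = d b a - 1" and t: "d c t = 1" "d b t = d b c - 1"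
    using sym d_sym[of s b] d_sym[of t b] by linarith+
  have dst: "d s t = 3" using tips_apart(1)[OF ac s t] flat by simp
  obtain x where x: "d s x + d t x = d s t" "d s t - d b s - d b t + 2 * d b x \<le> 2"
    using smaller[of s t] dst s t ac flat by force
  \<comment> \<open>The sides of this triple are 3, \<open>F - 1\<close>, \<open>F - 1\<close>; the
    slack is odd, hence at most 1.\<close>
  have bx: "d b x \<le> F - 2" using x dst s t flat by linarith
  have "d s x \<noteq> 0" "d t x \<noteq> 0"
    using bx s t flat d_tri[of b s x] d_tri[of b t x] d_sym[of x s] d_sym[of x t] by linarith+
  then have "d s x = 1 \<and> d t x = 2 \<or> d s x = 2 \<and> d t x = 1"
    using x dst d_nonneg[of s x] d_nonneg[of t x] by linarith
  then show False
  proof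
    assume "d s x = 1 \<and> d t x = 2"
    then show False using no_flat_point[OF ac flat s t _ _ bx] by blast
  next
    assume "d s x = 2 \<and> d t x = 1"
    then show False using m.no_flat_point[OF _ flat(2,1) t s _ _ bx] ac sym by simp
  qed
qed

end

section \<open>A vertex of slack at most 2 in every interval\<close>

context alpha1_space
begin

text \<open>The induction on the perimeter keeps \<open>b\<close> fixed and provides the assumption
  \<open>smaller\<close>.\<close>

theorem interval_near:
  "\<exists>p. d a p + d c p = d a c \<and> d a c - d b a - d b c + 2 * d b p \<le> 2"
proof (induction "nat (d a c + d b a + d b c)" arbitrary: a c rule: less_induct)
  case less
  obtain p where p: "d a p + d c p = d a c" "d a c - d b a - d b c + 2 * d b p \<le> 3"
    and min: "\<And>q. d a q + d c q = d a c \<Longrightarrow> d b p \<le> d b q"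
    using interval_minimum[of a c b] by blast
  show ?case
  proof (rule ccontr)
    assume bad: "\<not> ?thesis"
    then have "d a c - d b a - d b c + 2 * d b p = 3" using p by force
    then interpret minimal_counterexample d a b c "d b p"
    proof unfold_locales
      fix a' c' assume "d a' c' + d b a' + d b c' < d a c + d b a + d b c"
      then have "nat (d a' c' + d b a' + d b c') < nat (d a c + d b a + d b c)"
        using d_nonneg[of a' c'] d_nonneg[of b a'] d_nonneg[of b c'] by linarith
      then show "\<exists>p. d a' p + d c' p = d a' c' \<and> d a' c' - d b a' - d b c' + 2 * d b p \<le> 2"
        using less by blast
    qed (use min in auto)
    show False by (rule no_minimal_counterexample)
  qed
qed

subsection \<open>Distance to a geodesic\<close>

text \<open>Integer indices make reversal and shifts plain arithmetic. The ends \<open>p 0\<close>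
  and \<open>p (d a c)\<close> are only required to be at distance 0 from \<open>a\<close> and
  \<open>c\<close>.\<close>

definition geodesic :: "(int \<Rightarrow> 'a) \<Rightarrow> 'a \<Rightarrow> 'a \<Rightarrow> bool" where
  "geodesic p a c \<longleftrightarrow>
     (\<forall>i. 0 \<le> i \<and> i \<le> d a c \<longrightarrow> d a (p i) = i \<and> d c (p i) = d a c - i) \<and>
     (\<forall>i. 0 \<le> i \<and> i < d a c \<longrightarrow> d (p i) (p (i + 1)) = 1)"

lemma geodesicD:
  assumes "geodesic p a c"
  shows "\<lbrakk>0 \<le> i; i \<le> d a c\<rbrakk> \<Longrightarrow> d a (p i) = i"
    and "\<lbrakk>0 \<le> i; i \<le> d a c\<rbrakk> \<Longrightarrow> d c (p i) = d a c - i"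
    and "\<lbrakk>0 \<le> i; i < d a c\<rbrakk> \<Longrightarrow> d (p i) (p (i + 1)) = 1"
  using assms unfolding geodesic_def by auto

lemma geodesic_dist:
  assumes p: "geodesic p a c" and i: "0 \<le> i" and ij: "i \<le> j" and j: "j \<le> d a c"
  shows "d (p i) (p j) = j - i"
proof -
  have "j \<le> d a c \<longrightarrow> d (p i) (p j) \<le> j - i" using ij
  proof (induction j rule: int_ge_induct)
    case base
    then show ?case using d_self[of "p i"] by simp
  next
    case (step j)
    then show ?case using geodesicD(3)[OF p, of j] i d_tri[of "p i" "p (j + 1)" "p j"] by force
  qed
  then show ?thesis
    using j geodesicD(1)[OF p, of i] geodesicD(1)[OF p, of j] i ij d_tri[of a "p j" "p i"] by force
qed

lemma geodesic_ends:
  assumes "geodesic p a c"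
  shows "d b (p 0) = d b a" "d b (p (d a c)) = d b c"
  using geodesicD(1)[OF assms, of 0] geodesicD(2)[OF assms, of "d a c"] d_nonneg[of a c]
    d_tri[of b a "p 0"] d_tri[of b "p 0" a] d_sym[of a "p 0"]
    d_tri[of b c "p (d a c)"] d_tri[of b "p (d a c)" c] d_sym[of c "p (d a c)"]
  by linarith+

lemma geodesic_rev:
  assumes p: "geodesic p a c"
  shows "geodesic (\<lambda>i. p (d a c - i)) c a"
proof -
  have ca: "d c a = d a c" by (rule d_sym)
  have "d (p (d a c - i)) (p (d a c - (i + 1))) = 1" if "0 \<le> i" "i < d a c" for i
    using geodesicD(3)[OF p, of "d a c - i - 1"] that
      d_sym[of "p (d a c - i)" "p (d a c - i - 1)"]
    by (simp add: diff_diff_eq)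
  then show ?thesis
    using geodesicD(1,2)[OF p] unfolding geodesic_def ca by auto
qed

lemma geodesic_tail:
  assumes p: "geodesic p a c" and pos: "0 < d a c"
  shows "geodesic (\<lambda>i. p (i + 1)) (p 1) c" "d (p 1) c = d a c - 1"
proof -
  show len: "d (p 1) c = d a c - 1" using geodesicD(2)[OF p, of 1] pos d_sym[of c "p 1"] by simp
  show "geodesic (\<lambda>i. p (i + 1)) (p 1) c"
    unfolding geodesic_def len
  proof (intro conjI allI impI)
    fix i assume i: "0 \<le> i \<and> i \<le> d a c - 1"
    show "d (p 1) (p (i + 1)) = i" using geodesic_dist[OF p, of 1 "i + 1"] i by simp
    show "d c (p (i + 1)) = d a c - 1 - i" using geodesicD(2)[OF p, of "i + 1"] i by simp
  next
    fix i assume "0 \<le> i \<and> i < d a c - 1"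
    then show "d (p (i + 1)) (p (i + 1 + 1)) = 1" using geodesicD(3)[OF p, of "i + 1"] by simp
  qed
qed

section \<open>Geodesics through a given vertex of an interval\<close>

lemma descending_path:
  "\<exists>q. q 0 = x \<and> (\<forall>j. 0 \<le> j \<and> j \<le> d a x \<longrightarrow> d a (q j) = d a x - j) \<and>
     (\<forall>j. 0 \<le> j \<and> j < d a x \<longrightarrow> d (q j) (q (j + 1)) = 1)"
proof (induction "nat (d a x)" arbitrary: x)
  case 0
  then show ?case using d_nonneg[of a x] by (intro exI[of _ "\<lambda>_. x"]) auto
next
  case (Suc n)
  then have "0 < d x a" using d_sym[of a x] by linarith
  then obtain y where y: "d x y = 1" "d y a = d x a - 1" using d_step by blast
  have ay: "d a y = d a x - 1" using y d_sym[of a x] d_sym[of a y] by linarith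
  then have "n = nat (d a y)" using Suc(2) by linarith
  from Suc(1)[OF this] obtain q where q: "q 0 = y"
    "\<And>j. 0 \<le> j \<Longrightarrow> j \<le> d a y \<Longrightarrow> d a (q j) = d a y - j"
    "\<And>j. 0 \<le> j \<Longrightarrow> j < d a y \<Longrightarrow> d (q j) (q (j + 1)) = 1" by blast
  define q' where "q' j = (if j = 0 then x else q (j - 1))" for j
  have "d a (q' j) = d a x - j" if "0 \<le> j \<and> j \<le> d a x" for j
    using that q(2)[of "j - 1"] ay by (auto simp: q'_def)
  moreover have "d (q' j) (q' (j + 1)) = 1" if "0 \<le> j \<and> j < d a x" for j
    using that q(1) q(3)[of "j - 1"] y ay by (auto simp: q'_def)
  ultimately show ?case by (intro exI[of _ q']) (simp add: q'_def)
qed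

lemma geodesic_through:
  assumes x: "d a x + d c x = d a c"
  obtains p where "geodesic p a c" "p (d a x) = x"
proof -
  obtain q where q: "q 0 = x" "\<And>j. 0 \<le> j \<Longrightarrow> j \<le> d a x \<Longrightarrow> d a (q j) = d a x - j"
    "\<And>j. 0 \<le> j \<Longrightarrow> j < d a x \<Longrightarrow> d (q j) (q (j + 1)) = 1"
    using descending_path[of x a] by blast
  obtain r where r: "r 0 = x" "\<And>j. 0 \<le> j \<Longrightarrow> j \<le> d c x \<Longrightarrow> d c (r j) = d c x - j"
    "\<And>j. 0 \<le> j \<Longrightarrow> j < d c x \<Longrightarrow> d (r j) (r (j + 1)) = 1"
    using descending_path[of x c] by blast
  define p where "p i = (if i \<le> d a x then q (d a x - i) else r (i - d a x))" for i
  have edge: "d (p i) (p (i + 1)) = 1" if i: "0 \<le> i" "i < d a c" for i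
  proof (cases "i < d a x")
    case True
    then show ?thesis
      using q(3)[of "d a x - i - 1"] i d_sym[of "q (d a x - i - 1)" "q (d a x - i)"]
      by (simp add: p_def diff_diff_eq)
  next
    case False
    then have "p i = r (i - d a x)" using q(1) r(1) by (auto simp: p_def)
    moreover have "p (i + 1) = r (i - d a x + 1)" using False by (simp add: p_def algebra_simps)
    ultimately show ?thesis using r(3)[of "i - d a x"] False i x by simp
  qed
  have le: "j \<le> d a c \<longrightarrow> d (p i) (p j) \<le> j - i" if "0 \<le> i" "i \<le> j" for i j
    using that(2)
  proof (induction j rule: int_ge_induct)
    case base
    then show ?case using d_self[of "p i"] by simp
  next
    case (step j)
    then show ?case
      using \<open>0 \<le> i\<close> edge[of j]
        d_tri[of "p i" "p (j + 1)" "p j"] by force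
  qed
  have p0: "d a (p 0) = 0" using q(2)[of "d a x"] d_nonneg[of a x] by (simp add: p_def)
  have pn: "d c (p (d a c)) = 0"
  proof (cases "d c x = 0")
    case True
    then show ?thesis using x q(1) by (simp add: p_def)
  next
    case False
    moreover have "d a c - d a x = d c x" using x by linarith
    ultimately have "p (d a c) = r (d c x)" using d_nonneg[of c x] by (simp add: p_def)
    then show ?thesis using r(2)[of "d c x"] d_nonneg[of c x] by simp
  qed
  \<comment> \<open>Counting edges bounds both distances from above, and these bounds add up to
    \<open>d a c\<close>, so both are attained.\<close>
  have "d a (p i) = i \<and> d c (p i) = d a c - i" if "0 \<le> i \<and> i \<le> d a c" for i
    using that le[of 0 i] le[of i "d a c"] p0 pn d_tri[of a "p i" "p 0"]
      d_tri[of c "p i" "p (d a c)"] d_sym[of "p (d a c)" "p i"] d_tri[of a c "p i"]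
      d_sym[of c "p i"] by linarith
  then have "geodesic p a c" using edge unfolding geodesic_def by blast
  moreover have "p (d a x) = x" using q(1) by (simp add: p_def)
  ultimately show thesis by (rule that)
qed

text \<open>The ladder: a geodesic from a to x runs next to p, because two consecutive neighbours towards b
  or c are always adjacent. Its last but one vertex is too close to the vertex of p after level h.\<close>

lemma no_flat_start:
  assumes p: "geodesic p a c"
    and lo: "\<And>i. \<lbrakk>0 \<le> i; i \<le> d a c\<rbrakk> \<Longrightarrow> k \<le> d b (p i)"
    and five: "d a c - d b a - d b c + 2 * k = 5"
    and first: "d b (p 1) = d b a"
    and x: "d a x + d c x = d a c" "d b x = k - 2" "d b x + d a x = d b a"
  shows False
proof -
  note ad = geodesicD(1)[OF p] and cd = geodesicD(2)[OF p] and pstep = geodesicD(3)[OF p]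
  note pd = geodesic_dist[OF p] and ends = geodesic_ends[OF p, of b]
  define h where "h = d a x"
  define K where "K = d b a"
  have K: "K = k - 2 + h" using x by (simp add: h_def K_def)
  have h2: "2 \<le> h" using lo[of 0] ends d_nonneg[of a c] K by (simp add: K_def)
  have M: "d b c = d a c - h + k - 3" using five K by (simp add: K_def)
  then have hn: "h < d a c" using lo[of "d a c"] ends d_nonneg[of a c] by simp
  have al: "d a (p (h - 1)) = h - 1" "d a (p h) = h" "d a (p (h + 1)) = h + 1"
    "d c (p h) = d a c - h" "d c (p (h + 1)) = d a c - h - 1"
    using ad[of "h - 1"] ad[of h] ad[of "h + 1"] cd[of h] cd[of "h + 1"] h2 hn by simp_all
  \<comment> \<open>Both vertices have level \<open>h\<close> in the interval from \<open>a\<close>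
    to \<open>c\<close>; by \<open>lo\<close> their distance is then exactly 2.\<close>
  have "d (p h) x \<le> 2"
    by (rule slice_thin[of a _ c])
      (use al x d_sym[of c "p h"] d_sym[of c x] in \<open>unfold h_def, linarith\<close>)+
  then have ph: "d b (p h) = k" "d (p h) x = 2"
    using lo[of h] h2 hn x d_tri[of b "p h" x] d_sym[of x "p h"] by linarith+
  have s1: "d (p (h - 1)) (p h) = 1" "d (p h) (p (h + 1)) = 1"
    using pstep[of "h - 1"] pstep[of h] h2 hn by simp_all
  have "d b (p (h - 1)) \<noteq> k + 1"
  proof
    assume "d b (p (h - 1)) = k + 1"
    then have "d a (p (h - 1)) + d b (p h) \<le> d a b"
      using s1 al ph by (intro alpha1_sym) linarith+
    then show False using al ph K d_sym[of a b] by (simp add: K_def)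
  qed
  then have ph1: "d b (p (h - 1)) = k"
    using lo[of "h - 1"] h2 hn ph s1 d_tri[of b "p (h - 1)" "p h"] d_sym[of "p h" "p (h - 1)"]
    by linarith
  \<comment> \<open>The values at \<open>1\<close> and \<open>h - 1\<close> differ by
    \<open>h - 2\<close>, the number of steps between them, so each step descends by 1.\<close>
  have bp: "d b (p j) = K - j + 1" if "1 \<le> j" "j \<le> h - 1" for j
    using that pd[of 1 j] pd[of j "h - 1"] hn first ph1 K d_tri[of b "p 1" "p j"]
      d_sym[of "p 1" "p j"] d_tri[of b "p j" "p (h - 1)"] d_sym[of "p j" "p (h - 1)"] K_def
    by linarith
  obtain y where y: "geodesic y a x" using geodesic_through[of a x x] d_self[of x] by auto
  have yl: "d a (y j) = j" "d x (y j) = h - j" if "0 \<le> j" "j \<le> h" for j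
    using geodesicD(1,2)[OF y, of j] that by (simp_all add: h_def)
  have ystep: "d (y j) (y (j + 1)) = 1" if "0 \<le> j" "j < h" for j
    using geodesicD(3)[OF y, of j] that by (simp add: h_def)
  \<comment> \<open>\<open>x\<close> lies between \<open>a\<close> and \<open>b\<close> and also
    between \<open>a\<close> and \<open>c\<close>, so \<open>y\<close> approaches both
    \<open>b\<close> and \<open>c\<close> by 1 in each step.\<close>
  have yb: "d b (y j) = K - j" if "0 \<le> j" "j \<le> h" for j
    using yl[OF that] x K d_tri[of b a "y j"] d_sym[of a "y j"] d_tri[of b "y j" x]
      d_tri[of b "y j" a] d_sym[of "y j" a] K_def by linarith
  have yc: "d c (y j) = d a c - j" if "0 \<le> j" "j \<le> h" for j
    using yl[OF that] x d_tri[of a c "y j"] d_sym[of c "y j"] d_tri[of c "y j" x] h_def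
    by linarith
  have ladder: "j \<le> h - 1 \<longrightarrow> d (p j) (y j) = 1" if "1 \<le> j" for j
    using that
  proof (induction j rule: int_ge_induct)
    case base
    have "d a (p 1) = 1" "d a (y 1) = 1" "d c (p 1) = d a c - 1" "d c (y 1) = d a c - 1"
      using ad[of 1] cd[of 1] yl[of 1] yc[of 1] h2 hn by simp_all
    then have "d (p 1) (y 1) \<le> 1"
      using neighbours_adjacent[of a "p 1" "y 1" c] d_sym[of c "p 1"] d_sym[of c "y 1"] by simp
    moreover have "d (p 1) (y 1) \<noteq> 0"
      using yb[of 1] first h2 d_tri[of b "p 1" "y 1"] d_sym[of "y 1" "p 1"] K_def by linarith
    ultimately show ?case using d_nonneg[of "p 1" "y 1"] by linarith
  next
    case (step j)
    show ?case
    proof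
      assume j: "j + 1 \<le> h - 1"
      then have pj: "d (p j) (y j) = 1" using step by simp
      have b: "d b (p j) = K - j + 1" "d b (p (j + 1)) = K - j" "d b (y j) = K - j"
        "d b (y (j + 1)) = K - j - 1"
        using bp[of j] bp[of "j + 1"] yb[of j] yb[of "j + 1"] j step by simp_all
      have l: "d a (p (j + 1)) = j + 1" "d a (y j) = j" "d c (y j) = d a c - j"
        "d c (p (j + 1)) = d a c - j - 1" "d c (y (j + 1)) = d a c - j - 1"
        using ad[of "j + 1"] cd[of "j + 1"] yl[of j] yc[of j] yc[of "j + 1"] j step hn by simp_all
      have st: "d (p j) (p (j + 1)) = 1" "d (y j) (y (j + 1)) = 1"
        using pstep[of j] ystep[of j] j step hn by simp_all
      \<comment> \<open>Both are neighbours of \<open>p j\<close> towards \<open>b\<close>; next,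
        \<open>p (j + 1)\<close> and \<open>y (j + 1)\<close> are at distance at most 1 from
        \<open>y j\<close> and nearer to \<open>c\<close>.\<close>
      have "d (y j) (p (j + 1)) \<le> 1"
        by (rule neighbours_adjacent[of "p j" _ _ b])
          (use pj b st d_sym[of b "p j"] d_sym[of b "y j"] d_sym[of b "p (j + 1)"] in linarith)+
      then have "d (y j) (p (j + 1)) = 1" using l d_tri[of a "p (j + 1)" "y j"] by linarith
      then have "d (p (j + 1)) (y (j + 1)) \<le> 1"
        by (intro neighbours_adjacent[of "y j" _ _ c])
          (use l st d_sym[of c "y j"] d_sym[of c "p (j + 1)"] d_sym[of c "y (j + 1)"] in linarith)+
      moreover have "d (p (j + 1)) (y (j + 1)) \<noteq> 0"
        using b d_tri[of b "p (j + 1)" "y (j + 1)"] d_sym[of "y (j + 1)" "p (j + 1)"] by linarith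
      ultimately show "d (p (j + 1)) (y (j + 1)) = 1"
        using d_nonneg[of "p (j + 1)" "y (j + 1)"] by linarith
    qed
  qed
  define t where "t = y (h - 1)"
  define w where "w = p (h + 1)"
  have t: "d (p (h - 1)) t = 1" "d t x = 1" "d a t = h - 1" "d c t = d a c - h + 1" "d b t = k - 1"
    using ladder[of "h - 1"] yl[of "h - 1"] yb[of "h - 1"] yc[of "h - 1"] h2 K d_sym[of t x]
    by (simp_all add: t_def)
  have wl: "d a w = h + 1" "d c w = d a c - h - 1" "d (p h) w = 1" "d w (p h) = 1"
    using al s1 d_sym[of w "p h"] by (simp_all add: w_def)
  have xw: "d w x \<le> 2"
  proof (rule ccontr)
    assume "\<not> d w x \<le> 2"
    then have "d x w = d x (p h) + 1"
      using ph wl d_tri[of x w "p h"] d_sym[of x "p h"] d_sym[of x w] by linarith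
    then have "d c w + d x (p h) \<le> d c x"
      using wl al by (intro alpha1_sym) linarith+
    then show False using al wl ph x d_sym[of x "p h"] h_def by linarith
  qed
  have bw: "d b w = k"
    using xw x lo[of "h + 1"] h2 hn d_tri[of b w x] d_tri[of b w "p h"] wl ph d_sym[of x w]
    by (simp add: w_def)
  have tx: "d (p (h - 1)) t + d t x = d (p (h - 1)) x"
    using t ph1 x d_tri[of "p (h - 1)" x t] d_tri[of b "p (h - 1)" x] d_sym[of x "p (h - 1)"]
    by linarith
  have "d w (p (h - 1)) \<le> 2"
    using pd[of "h - 1" "h + 1"] h2 hn d_sym[of w "p (h - 1)"] by (simp add: w_def)
  then have "d w t \<le> 2" using disc_convex[OF _ xw tx] by blast
  then have "d w t = 2" using wl t d_tri[of a w t] d_sym[of t w] by linarith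
  then obtain e where e: "d w e = 1" "d e t = 1" using d_between[of 1 w t] by force
  have sym: "d t e = d e t" "d e w = d w e" "d c b = d b c" "d e c = d c e" by (rule d_sym)+
  have ce: "d c e = d a c - h"
    using e t wl sym d_tri[of a w e] d_tri[of a e t] d_tri[of c e w] d_tri[of a c e]
      d_tri[of c t e] by linarith
  have be: "k - 1 \<le> d b e" "d b e \<le> k"
    using e t bw sym d_tri[of b w e] d_tri[of b e t] by linarith+
  \<comment> \<open>One of the edges from \<open>w\<close> to \<open>e\<close> and from
    \<open>e\<close> to \<open>t\<close> leads towards \<open>b\<close>. Both lead away from
    \<open>c\<close>, so \<open>alpha1\<close> makes \<open>d c b\<close> larger than
    \<open>M\<close> allows.\<close>
  then consider "d b e = k - 1" | "d b e = k" by linarith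
  then show False
  proof cases
    case 1
    then have "d c w + d b e \<le> d c b" using e ce wl bw by (intro alpha1_sym) linarith+
    then show False using 1 M wl sym by linarith
  next
    case 2
    then have "d c e + d b t \<le> d c b" using e t ce by (intro alpha1_sym) linarith+
    then show False using 2 M ce t sym by linarith
  qed
qed

text \<open>A first step away from \<open>b\<close> would give the start slack at most 1. A first
  step towards \<open>b\<close> would leave the slacks unchanged on the shorter tail. A flat step
  lowers them by 1 there, so slack 4 on the tail is slack 5 on the whole geodesic.\<close>

lemma flat_start:
  assumes p: "geodesic p a c"
    and bad: "\<And>i. \<lbrakk>0 \<le> i; i \<le> d a c\<rbrakk> \<Longrightarrow> 4 < d a c - d b a - d b c + 2 * d b (p i)"
    and shorter: "\<And>q a' c'. \<lbrakk>geodesic q a' c'; d a' c' < d a c\<rbrakk> \<Longrightarrow>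
      \<exists>i. 0 \<le> i \<and> i \<le> d a' c' \<and> d a' c' - d b a' - d b c' + 2 * d b (q i) \<le> 4"
  shows "d b (p 1) = d b a"
    and "\<exists>i. 0 \<le> i \<and> i \<le> d a c \<and> d a c - d b a - d b c + 2 * d b (p i) = 5"
proof -
  note ends = geodesic_ends[OF p, of b]
  have pos: "0 < d a c"
  proof (rule ccontr)
    assume "\<not> 0 < d a c"
    then have "d a c = 0" using d_nonneg[of a c] by linarith
    then show False using bad[of 0] ends by simp
  qed
  have s: "d (p 0) (p 1) = 1" "d c (p 0) = d a c" "d c (p 1) = d a c - 1"
    using geodesicD(2,3)[OF p, of 0] geodesicD(2)[OF p, of 1] pos by simp_all
  have "d b (p 1) \<noteq> d b a + 1"
  proof
    assume "d b (p 1) = d b a + 1"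
    then have "d b (p 0) + d c (p 1) \<le> d b c" using s ends by (intro alpha1_sym) simp_all
    then show False using bad[of 0] s ends pos by simp
  qed
  moreover obtain i where i: "0 \<le> i" "i \<le> d a c - 1"
    "d a c - 1 - d b (p 1) - d b c + 2 * d b (p (i + 1)) \<le> 4"
    using shorter[OF geodesic_tail(1)[OF p pos]] geodesic_tail(2)[OF p pos] by auto
  have bad': "4 < d a c - d b a - d b c + 2 * d b (p (i + 1))" using bad[of "i + 1"] i by simp
  then have "d b (p 1) \<noteq> d b a - 1" using i by linarith
  ultimately show *: "d b (p 1) = d b a"
    using s ends d_tri[of b "p 1" "p 0"] d_tri[of b "p 0" "p 1"] d_sym[of "p 1" "p 0"] by linarith
  then have "d a c - d b a - d b c + 2 * d b (p (i + 1)) = 5" using i bad' by linarith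
  then show "\<exists>i. 0 \<le> i \<and> i \<le> d a c \<and> d a c - d b a - d b c + 2 * d b (p i) = 5"
    using i by (intro exI[of _ "i + 1"]) simp
qed

theorem geodesic_near:
  assumes "geodesic p a c"
  shows "\<exists>i. 0 \<le> i \<and> i \<le> d a c \<and> d a c - d b a - d b c + 2 * d b (p i) \<le> 4"
  using assms
proof (induction "nat (d a c)" arbitrary: p a c rule: less_induct)
  case less
  note p = less.prems
  have shorter: "\<exists>i. 0 \<le> i \<and> i \<le> d a' c' \<and> d a' c' - d b a' - d b c' + 2 * d b (q i) \<le> 4"
    if "geodesic q a' c'" "d a' c' < d a c" for q a' c'
    using less.hyps[OF _ that(1)] that d_nonneg[of a' c'] by simp
  show ?case
  proof (rule ccontr)
    assume "\<not> ?thesis"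
    then have bad: "4 < d a c - d b a - d b c + 2 * d b (p i)" if "0 \<le> i" "i \<le> d a c" for i
      using that by force
    define q where "q i = p (d a c - i)" for i
    have q: "geodesic q c a" using geodesic_rev[OF p] by (simp add: q_def[abs_def])
    have ca: "d c a = d a c" by (rule d_sym)
    obtain j where j: "0 \<le> j" "j \<le> d a c" "d a c - d b a - d b c + 2 * d b (p j) = 5"
      using flat_start(2)[OF p bad shorter] by blast
    define k where "k = d b (p j)"
    have k: "d a c - d b a - d b c + 2 * k = 5" using j by (simp add: k_def)
    have lo: "k \<le> d b (p i)" if "0 \<le> i" "i \<le> d a c" for i using bad[OF that] k by linarith
    have p1: "d b (p 1) = d b a" by (rule flat_start(1)[OF p bad shorter])
    have q1: "d b (q 1) = d b c"
    proof (rule flat_start(1)[OF q])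
      show "4 < d c a - d b c - d b a + 2 * d b (q i)" if "0 \<le> i" "i \<le> d c a" for i
        using bad[of "d a c - i"] that ca by (simp add: q_def)
      show "\<exists>i. 0 \<le> i \<and> i \<le> d a' c' \<and> d a' c' - d b a' - d b c' + 2 * d b (r i) \<le> 4"
        if "geodesic r a' c'" "d a' c' < d c a" for r a' c'
        using shorter[OF that(1)] that ca by simp
    qed
    obtain x where x: "d a x + d c x = d a c" "d a c - d b a - d b c + 2 * d b x \<le> 2"
      using interval_near[of a c b] by blast
    have tri: "d b a \<le> d b x + d a x" "d b c \<le> d b x + d c x"
      using d_tri[of b a x] d_tri[of b c x] d_sym[of a x] d_sym[of c x] by linarith+
    \<comment> \<open>The slack of \<open>x\<close> is nonnegative, odd like 5, and at most 2, hence
      1. It is the sum of the detours via \<open>x\<close> to \<open>a\<close> and to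
      \<open>c\<close>, so one of them is 0.\<close>
    then have bx: "d b x = k - 2" using x k by linarith
    from tri x k bx consider "d b x + d a x = d b a" | "d b x + d c x = d b c" by linarith
    then show False
    proof cases
      case 1
      then show False using no_flat_start[OF p lo k p1 x(1) bx] by blast
    next
      case 2
      show False
      proof (rule no_flat_start[OF q _ _ q1 _ bx 2])
        show "k \<le> d b (q i)" if "0 \<le> i" "i \<le> d c a" for i
          using lo[of "d a c - i"] that ca by (simp add: q_def)
      qed (use k x ca in simp_all)
    qed
  qed
qed

subsection \<open>The four-point condition\<close>

text \<open>The edge entering \<open>p u\<close> leads away from \<open>a\<close> and towards
  \<open>b\<close>, so \<open>alpha1\<close> applies to it.\<close>

lemma first_minimum:
  assumes p: "geodesic p a c" and u: "0 \<le> u" "u \<le> d a c"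
    and least: "\<And>i. \<lbrakk>0 \<le> i; i \<le> d a c\<rbrakk> \<Longrightarrow> d b (p u) \<le> d b (p i)"
    and first: "\<And>i. \<lbrakk>0 \<le> i; i < u\<rbrakk> \<Longrightarrow> d b (p i) \<noteq> d b (p u)"
  shows "d b (p u) + u \<le> d b a + 1"
proof (cases "u = 0")
  case True
  then show ?thesis using geodesic_ends(1)[OF p, of b] by simp
next
  case False
  then have s: "d (p (u - 1)) (p u) = 1" "d a (p (u - 1)) = u - 1" "d a (p u) = u"
    using geodesicD(3)[OF p, of "u - 1"] geodesicD(1)[OF p, of "u - 1"] geodesicD(1)[OF p u] u
    by simp_all
  have "d b (p (u - 1)) = d b (p u) + 1"
    using least[of "u - 1"] first[of "u - 1"] False u s(1) d_tri[of b "p (u - 1)" "p u"]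
      d_sym[of "p u" "p (u - 1)"] by linarith
  then have "d a (p (u - 1)) + d b (p u) \<le> d a b" using s by (intro alpha1_sym) linarith+
  then show ?thesis using s d_sym[of a b] by linarith
qed

text \<open>Convexity of a disc around \<open>b\<close> makes the indices of minimal distance a
  range; \<open>first_minimum\<close> for the geodesic and its reversal bounds its two ends.\<close>

lemma minimum_range:
  assumes p: "geodesic p a c"
  obtains u v where "0 \<le> u" "u \<le> v" "v \<le> d a c"
    "\<And>i. \<lbrakk>u \<le> i; i \<le> v\<rbrakk> \<Longrightarrow> d b (p i) = d b (p u)"
    "\<And>i. \<lbrakk>0 \<le> i; i \<le> d a c\<rbrakk> \<Longrightarrow> d b (p u) \<le> d b (p i)"
    "d b (p u) + u \<le> d b a + 1" "d b (p u) + (d a c - v) \<le> d b c + 1"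
proof -
  let ?f = "\<lambda>i. d b (p i)"
  define m where "m = Min (?f ` {0..d a c})"
  define S where "S = {i \<in> {0..d a c}. ?f i = m}"
  have ne: "{0..d a c} \<noteq> {}" using d_nonneg[of a c] by simp
  have least: "m \<le> ?f i" if "0 \<le> i" "i \<le> d a c" for i using that by (simp add: m_def)
  have "m \<in> ?f ` {0..d a c}" unfolding m_def using ne by (intro Min_in) auto
  then have "S \<noteq> {}" by (auto simp: S_def)
  moreover have "finite S" unfolding S_def by (rule finite_subset[of _ "{0..d a c}"]) auto
  ultimately have S: "finite S" "S \<noteq> {}" by blast+
  define u where "u = Min S"
  define v where "v = Max S"
  have u: "u \<in> S" "\<And>i. i \<in> S \<Longrightarrow> u \<le> i" using S by (auto simp: u_def)
  have v: "v \<in> S" "\<And>i. i \<in> S \<Longrightarrow> i \<le> v" using S by (auto simp: v_def)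
  have range: "0 \<le> u" "u \<le> v" "v \<le> d a c" "?f u = m" "?f v = m" using u v by (auto simp: S_def)
  have between: "?f i = m" if i: "u \<le> i" "i \<le> v" for i
  proof -
    have "d (p u) (p i) + d (p i) (p v) = d (p u) (p v)"
      using geodesic_dist[OF p, of u i] geodesic_dist[OF p, of i v] geodesic_dist[OF p, of u v]
        i range by simp
    then have "?f i \<le> m" using disc_convex[of b "p u" m "p v" "p i"] range by simp
    then show ?thesis using least[of i] i range by simp
  qed
  have start: "?f u + u \<le> d b a + 1"
    by (rule first_minimum[OF p]) (use u range least in \<open>force simp: S_def\<close>)+
  have ca: "d c a = d a c" by (rule d_sym)
  have "d b ((\<lambda>i. p (d a c - i)) (d a c - v)) + (d a c - v) \<le> d b c + 1"
  proof (rule first_minimum[OF geodesic_rev[OF p]])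
    fix i assume "0 \<le> i" "i < d a c - v"
    then show "d b (p (d a c - i)) \<noteq> d b (p (d a c - (d a c - v)))"
      using v(2)[of "d a c - i"] range by (auto simp: S_def)
  qed (use range least ca in auto)
  then show thesis using that[of u v] range between least start by simp
qed

text \<open>Disjoint ranges of minima give the first alternative, the two summands 1 of
  \<open>minimum_range\<close> adding up to 2. Overlapping ranges let the route from
  \<open>b\<close> to \<open>e\<close> pass through a common minimum, and the slack bounds give the
  second.\<close>

lemma four_point_path:
  assumes p: "geodesic p a c"
    and i: "0 \<le> i" "i \<le> d a c" "d a c - d b a - d b c + 2 * d b (p i) \<le> s"
    and j: "0 \<le> j" "j \<le> d a c" "d a c - d e a - d e c + 2 * d e (p j) \<le> t"
  shows "d a c + d b e \<le> max (d a b + d c e) (d a e + d b c) + 2 \<or>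
    2 * d a c + 2 * d b e \<le> d a b + d c e + (d a e + d b c) + s + t"
proof -
  obtain u v where uv: "0 \<le> u" "u \<le> v" "v \<le> d a c"
    "\<And>i. \<lbrakk>u \<le> i; i \<le> v\<rbrakk> \<Longrightarrow> d b (p i) = d b (p u)"
    "\<And>i. \<lbrakk>0 \<le> i; i \<le> d a c\<rbrakk> \<Longrightarrow> d b (p u) \<le> d b (p i)"
    "d b (p u) + u \<le> d b a + 1" "d b (p u) + (d a c - v) \<le> d b c + 1"
    using minimum_range[OF p, of b] by blast
  obtain u' v' where uv': "0 \<le> u'" "u' \<le> v'" "v' \<le> d a c"
    "\<And>i. \<lbrakk>u' \<le> i; i \<le> v'\<rbrakk> \<Longrightarrow> d e (p i) = d e (p u')"
    "\<And>i. \<lbrakk>0 \<le> i; i \<le> d a c\<rbrakk> \<Longrightarrow> d e (p u') \<le> d e (p i)"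
    "d e (p u') + u' \<le> d e a + 1" "d e (p u') + (d a c - v') \<le> d e c + 1"
    using minimum_range[OF p, of e] by blast
  have sym: "d b a = d a b" "d e a = d a e" "d e c = d c e" by (rule d_sym)+
  have tri: "d b e \<le> d b (p i) + d e (p i)" for i using d_tri[of b e "p i"] d_sym[of e "p i"] by simp
  have f: "d b (p v) = d b (p u)" "d e (p v') = d e (p u')"
    using uv(4)[of v] uv(2) uv'(4)[of v'] uv'(2) by simp_all
  consider "v' \<le> u" | "v \<le> u'" | "u < v'" "u' < v" by linarith
  then show ?thesis
  proof cases
    case 1
    have "d e (p u) \<le> d e (p v') + (u - v')"
      using geodesic_dist[OF p, of v' u] 1 uv uv' d_tri[of e "p u" "p v'"] by linarith
    then show ?thesis using tri[of u] uv(6) uv'(7) f sym by linarith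
  next
    case 2
    have "d b (p u') \<le> d b (p v) + (u' - v)"
      using geodesic_dist[OF p, of v u'] 2 uv uv' d_tri[of b "p u'" "p v"] by linarith
    then show ?thesis using tri[of u'] uv(7) uv'(6) f sym by linarith
  next
    case 3
    define k where "k = max u u'"
    have k: "u \<le> k" "k \<le> v" "u' \<le> k" "k \<le> v'" using 3 uv(2) uv'(2) by (auto simp: k_def)
    have "d b e \<le> d b (p u) + d e (p u')"
      using tri[of k] uv(4)[OF k(1,2)] uv'(4)[OF k(3,4)] by simp
    also have "\<dots> \<le> d b (p i) + d e (p j)" using uv(5)[OF i(1,2)] uv'(5)[OF j(1,2)] by simp
    finally have "2 * d a c + 2 * d b e \<le> d a b + d c e + (d a e + d b c) + s + t"
      using i(3) j(3) sym by linarith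
    then show ?thesis ..
  qed
qed

text \<open>The geodesic passes through a vertex of slack at most 2 for \<open>b\<close> and
  contains one of slack at most 4 for \<open>e\<close>. The parameter \<open>s\<close> leaves room
  for parity to sharpen the first bound.\<close>

lemma four_point_slack:
  assumes "\<And>x. \<lbrakk>d a x + d c x = d a c; d a c - d b a - d b c + 2 * d b x \<le> 2\<rbrakk> \<Longrightarrow>
    d a c - d b a - d b c + 2 * d b x \<le> s"
  shows "d a c + d b e \<le> max (d a b + d c e) (d a e + d b c) + 2 \<or>
    2 * d a c + 2 * d b e \<le> d a b + d c e + (d a e + d b c) + s + 4"
proof -
  obtain x where x: "d a x + d c x = d a c" "d a c - d b a - d b c + 2 * d b x \<le> 2"
    using interval_near[of a c b] by blast
  obtain p where p: "geodesic p a c" "p (d a x) = x" using geodesic_through[OF x(1)] by blast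
  obtain j where "0 \<le> j" "j \<le> d a c" "d a c - d e a - d e c + 2 * d e (p j) \<le> 4"
    using geodesic_near[OF p(1), of e] by blast
  then show ?thesis
    using four_point_path[OF p(1), of "d a x" b s j e 4] assms[OF x] p(2) x(1)
      d_nonneg[of a x] d_nonneg[of c x] by simp
qed

text \<open>An odd slack of at most 2 is at most 1. The second alternative then has the constant 5,
  and halving it in integers leaves 2.\<close>

lemma four_point_odd:
  assumes "odd (d a b + d b c + d a c)"
  shows "d a c + d b e \<le> max (d a b + d c e) (d a e + d b c) + 2"
proof -
  have "d a c - d b a - d b c + 2 * d b x \<le> 1" if "d a c - d b a - d b c + 2 * d b x \<le> 2" for x
  proof -
    have "d a c - d b a - d b c + 2 * d b x \<noteq> 2"
    proof
      assume "d a c - d b a - d b c + 2 * d b x = 2"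
      then have "d a b + d b c + d a c = 2 * (1 + d a b + d b c - d b x)"
        using d_sym[of a b] by simp
      then show False using assms by (metis dvd_triv_left)
    qed
    then show ?thesis using that by linarith
  qed
  then show ?thesis using four_point_slack[of a c b 1 e] by auto
qed

text \<open>If both triangles on the diagonal from a to c have even perimeter, then the bound can only
  fail by 1, with equality of the two smaller sums; this makes the triangles on the other diagonal odd.\<close>

theorem four_point:
  "d a c + d b e \<le> max (d a b + d c e) (d a e + d b c) + 2"
proof (cases "odd (d a b + d b c + d a c) \<or> odd (d a e + d e c + d a c)")
  case True
  then show ?thesis
  proof
    assume "odd (d a b + d b c + d a c)"
    then show ?thesis by (rule four_point_odd)
  next
    assume "odd (d a e + d e c + d a c)"
    then have "d a c + d e b \<le> max (d a e + d c b) (d a b + d e c) + 2" by (rule four_point_odd)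
    then show ?thesis using d_sym[of e b] d_sym[of c b] d_sym[of e c] by (simp add: max.commute)
  qed
next
  case False
  show ?thesis
  proof (rule ccontr)
    assume bad: "\<not> ?thesis"
    then have "2 * d a c + 2 * d b e \<le> d a b + d c e + (d a e + d b c) + 2 + 4"
      using four_point_slack[of a c b 2 e] by blast
    moreover have "d a b + d c e + 3 \<le> d a c + d b e" "d a e + d b c + 3 \<le> d a c + d b e"
      using bad by linarith+
    ultimately have eq: "d a c + d b e = d a b + d c e + 3" "d a c + d b e = d a e + d b c + 3"
      by linarith+
    have sym: "d b a = d a b" "d e c = d c e" by (rule d_sym)+
    \<comment> \<open>By the first equation of \<open>eq\<close>, the triangles \<open>a\<close>,
      \<open>b\<close>, \<open>e\<close> and \<open>a\<close>, \<open>e\<close>, \<open>c\<close>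
      have perimeters of opposite parity.\<close>
    have "d b a + d a e + d b e = 2 * (d a b + 1 - d a c) + 1 + (d a e + d e c + d a c)"
      using eq sym by simp
    moreover have "even (d a e + d e c + d a c)" using False by blast
    ultimately have "odd (d b a + d a e + d b e)" by (metis odd_even_add odd_two_times_div_two_succ
      even_add dvd_triv_left odd_one)
    then have "d b e + d a c \<le> max (d b a + d e c) (d b c + d a e) + 2" by (rule four_point_odd)
    then show False using bad sym by (simp add: add.commute)
  qed
qed

end

section \<open>Connected graphs\<close>

lemma (in wf_digraph) symmetric_awalk_rev:
  assumes "symmetric G" "awalk u p v"
  shows "\<exists>q. awalk v q u \<and> length q = length p"
  using assms(2)
proof (induction p arbitrary: u)
  case Nil
  then show ?case by (auto simp: awalk_Nil_iff)
next
  case (Cons e es)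
  then have e: "e \<in> arcs G" "u = tail G e" and "awalk (head G e) es v"
    by (auto simp: awalk_Cons_iff)
  then obtain q where q: "awalk v q (head G e)" "length q = length es" using Cons.IH by blast
  obtain e' where "e' \<in> arcs G" "tail G e' = head G e" "head G e' = tail G e"
    using assms(1) e(1) unfolding symmetric_conv by metis
  then have "awalk (head G e) [e'] u" using e by (simp add: awalk_Cons_iff awalk_Nil_iff)
  then show ?case using q awalk_appendI by (intro exI[of _ "q @ [e']"]) auto
qed

text \<open>An integer copy of \<open>gdist\<close>, since the parity arguments and the indices of
  geodesics need integers.\<close>

definition hop_dist :: "('a, 'b) pre_digraph \<Rightarrow> 'a \<Rightarrow> 'a \<Rightarrow> int" where
  "hop_dist G u v = int (LEAST n. \<exists>p. pre_digraph.awalk G u p v \<and> length p = n)"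

lemma hop_dist_le:
  assumes "pre_digraph.awalk G u p v"
  shows "hop_dist G u v \<le> length p"
  unfolding hop_dist_def using assms by (auto intro: Least_le)

section \<open>Metric properties of the hop distance\<close>

locale connected_graph = graph G for G :: "('a, 'b) pre_digraph" +
  assumes conn: "connected G"
begin

lemma shortest_walk:
  assumes "u \<in> verts G" "v \<in> verts G"
  obtains p where "awalk u p v" "hop_dist G u v = length p"
proof -
  have "u \<rightarrow>\<^sup>*\<^bsub>mk_symmetric G\<^esub> v"
    using conn assms by (simp add: connected_def strongly_connected_def)
  then have "u \<rightarrow>\<^sup>*\<^bsub>G\<^esub> v" using sym_arcs by (simp add: reachable_mk_symmetric_eq)
  then obtain q where "awalk u q v" by (auto simp: reachable_awalk)
  then have "\<exists>n p. awalk u p v \<and> length p = n" by blast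
  then have "\<exists>p. awalk u p v \<and> length p = (LEAST n. \<exists>p. awalk u p v \<and> length p = n)"
    by (rule LeastI_ex)
  then show thesis using that by (auto simp: hop_dist_def)
qed

lemma gdist_hop_dist:
  assumes "u \<in> verts G" "v \<in> verts G"
  shows "gdist G u v = hop_dist G u v"
  using gdist_eq_Least[OF graph_axioms conn assms] by (simp add: hop_dist_def)

lemma hop_dist_self: "u \<in> verts G \<Longrightarrow> hop_dist G u u = 0"
  using hop_dist_le[of G u "[]" u] by (simp add: awalk_Nil_iff hop_dist_def)

lemma hop_dist_sym:
  assumes "u \<in> verts G" "v \<in> verts G"
  shows "hop_dist G u v = hop_dist G v u"
proof -
  have "hop_dist G y x \<le> hop_dist G x y" if xy: "x \<in> verts G" "y \<in> verts G" for x y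
  proof -
    obtain p where p: "awalk x p y" "hop_dist G x y = length p" using shortest_walk[OF xy] .
    obtain q where "awalk y q x" "length q = length p"
      using symmetric_awalk_rev[OF sym_arcs p(1)] by blast
    then show ?thesis using hop_dist_le[of G y q x] p(2) by simp
  qed
  then show ?thesis using assms by (simp add: antisym)
qed

lemma hop_dist_triangle:
  assumes "u \<in> verts G" "v \<in> verts G" "w \<in> verts G"
  shows "hop_dist G u w \<le> hop_dist G u v + hop_dist G v w"
proof -
  obtain p q where p: "awalk u p v" "hop_dist G u v = length p"
    and q: "awalk v q w" "hop_dist G v w = length q"
    using assms by (meson shortest_walk)
  then show ?thesis using hop_dist_le[OF awalk_appendI[OF p(1) q(1)]] by simp
qed

lemma hop_dist_step:
  assumes "u \<in> verts G" "v \<in> verts G" "0 < hop_dist G u v"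
  obtains w where "w \<in> verts G" "hop_dist G u w = 1" "hop_dist G w v = hop_dist G u v - 1"
proof -
  obtain p where p: "awalk u p v" "hop_dist G u v = length p" using shortest_walk[OF assms(1,2)] .
  then obtain e es where es: "p = e # es" using assms(3) by (cases p) auto
  then have e: "e \<in> arcs G" "u = tail G e" "awalk (head G e) es v"
    using p(1) by (auto simp: awalk_Cons_iff)
  then have h: "head G e \<in> verts G" by simp
  have "awalk u [e] (head G e)" using e h by (simp add: awalk_Cons_iff awalk_Nil_iff)
  then have "hop_dist G u (head G e) \<le> 1" using hop_dist_le[of G u "[e]"] by simp
  moreover have "hop_dist G (head G e) v \<le> hop_dist G u v - 1"
    using hop_dist_le[OF e(3)] p(2) es by simp
  ultimately show thesis
    using that[OF h] hop_dist_triangle[OF assms(1) h assms(2)] by linarith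
qed

lemma hop_dist_one:
  assumes "u \<in> verts G" "v \<in> verts G" "hop_dist G u v = 1"
  shows "u \<rightarrow>\<^bsub>G\<^esub> v"
proof -
  obtain p where p: "awalk u p v" "hop_dist G u v = length p" using shortest_walk[OF assms(1,2)] .
  then obtain e where "p = [e]" using assms(3) by (auto simp: length_Suc_conv One_nat_def)
  then show ?thesis using p(1) by (auto simp: awalk_Cons_iff awalk_Nil_iff arcs_ends_conv)
qed

text \<open>The locale concerns a whole type; the retraction \<open>r\<close> places every other
  element at distance 0 from a vertex.\<close>

lemma alpha1_space_retract:
  assumes alpha: "alpha1_metric G" and r: "\<And>x. r x \<in> verts G" "\<And>x. x \<in> verts G \<Longrightarrow> r x = x"
  shows "alpha1_space (\<lambda>x y. hop_dist G (r x) (r y))"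
proof
  show "\<exists>z. hop_dist G (r x) (r z) = 1 \<and> hop_dist G (r z) (r y) = hop_dist G (r x) (r y) - 1"
    if xy: "0 < hop_dist G (r x) (r y)" for x y
  proof -
    obtain z where "z \<in> verts G" "hop_dist G (r x) z = 1"
      "hop_dist G z (r y) = hop_dist G (r x) (r y) - 1"
      using hop_dist_step[OF r(1) r(1) xy] .
    then show ?thesis using r(2) by (intro exI[of _ z]) simp
  qed
next
  fix v w u x
  assume h: "hop_dist G (r v) (r w) = 1" "hop_dist G (r u) (r w) = hop_dist G (r u) (r v) + 1"
    "hop_dist G (r v) (r x) = hop_dist G (r w) (r x) + 1"
  have "r v \<in> interval G (r u) (r w)" "r w \<in> interval G (r v) (r x)"
    using h r(1) by (simp_all add: interval_def gdist_hop_dist)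
  moreover have "r v \<rightarrow>\<^bsub>G\<^esub> r w" using hop_dist_one[OF r(1) r(1) h(1)] .
  ultimately have "gdist G (r u) (r x) \<ge> gdist G (r u) (r v) + gdist G (r v) (r x) - 1"
    using alpha r(1) unfolding alpha1_metric_def by blast
  then have "hop_dist G (r u) (r x) \<ge> hop_dist G (r u) (r v) + hop_dist G (r v) (r x) - 1"
    using r(1) by (simp add: gdist_hop_dist)
  then show "hop_dist G (r u) (r v) + hop_dist G (r w) (r x) \<le> hop_dist G (r u) (r x)"
    using h by simp
qed (rule hop_dist_self hop_dist_sym hop_dist_triangle; rule r(1))+

end

theorem theorem4:
  fixes G :: "('a, 'b) pre_digraph"
  assumes "graph G"
    and "connected G"
    and "alpha1_metric G"
  shows "hyperbolic 1 G"
proof -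
  interpret connected_graph G
    using assms(1,2) by (simp add: connected_graph_def connected_graph_axioms_def)
  show ?thesis unfolding hyperbolic_def
  proof (intro ballI impI)
    fix u v w x assume V: "u \<in> verts G" "v \<in> verts G" "w \<in> verts G" "x \<in> verts G"
      and le: "gdist G u v + gdist G w x \<le> gdist G u w + gdist G v x \<and>
        gdist G u w + gdist G v x \<le> gdist G u x + gdist G v w"
    \<comment> \<open>The vertex \<open>u\<close> serves as the image of all elements outside the
      graph.\<close>
    define r where "r y = (if y \<in> verts G then y else u)" for y
    interpret alpha1_space "\<lambda>x y. hop_dist G (r x) (r y)"
      by (rule alpha1_space_retract[OF assms(3)]) (auto simp: r_def V)
    have "hop_dist G u x + hop_dist G v w \<le>
        max (hop_dist G u v + hop_dist G x w) (hop_dist G u w + hop_dist G v x) + 2"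
      using four_point[of u x v w] V by (simp add: r_def)
    then show "gdist G u x + gdist G v w - gdist G u w - gdist G v x \<le> 2 * 1"
      using le V hop_dist_sym[of x w] by (simp add: gdist_hop_dist)
  qed
qed

end
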